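(* For every integer $\beta\ge 1$ the quadratic unitary Cayley graph $\mathcal{G}_{\mathbb{Z}_{3^\beta}}$ is integral and periodic, and for every integer $\alpha\ge 3$ the quadratic unitary Cayley graph $\mathcal{G}_{\mathbb{Z}_{2^\alpha}}$ is nonintegral and periodic. Thus there are infinitely many integral graphs that are periodic, and infinitely many nonintegral graphs that are periodic.
   Context: Quadratic unitary Cayley graph: let $\mathbb{Z}_n$ be the ring of integers modulo $n$, $\mathbb{Z}_n^*$ its group of units, $Q_n=\{r^2: r\in\mathbb{Z}_n^*\}$ and $V_n=Q_n\cup(-Q_n)$. The graph $\mathcal{G}_{\mathbb{Z}_n}$ has vertex set $\mathbb{Z}_n$, and $u,v$ are adjacent if and only if $u-v\in V_n$. A graph is called integral if all the eigenvalues of its adjacency matrix are integers; otherwise it is called nonintegral. Grover walk: for a finite simple connected graph $G$ with vertex set $V(G)$ and edge set $E(G)$, let $\mathcal{A}(G)=\{(u,v),(v,u): uv\in E(G)\}$ be its set of arcs; for an arc $a=(u,v)$ put $o(a)=u$, $t(a)=v$, $a^{-1}=(v,u)$. Define the boundary matrix $N\in\mathbb{C}^{V(G)\times\mathcal{A}(G)}$ by $N_{xa}=\frac{1}{\sqrt{\deg x}}\delta_{x,t(a)}$, the coin matrix $C=2N^*N-I$, the shift matrix $R\in\mathbb{C}^{\mathcal{A}(G)\times\mathcal{A}(G)}$ by $R_{ab}=\delta_{a,b^{-1}}$, and the time evolution matrix $U=RC$. The graph $G$ is called periodic if there is a positive integer $\tau$ with $U^\tau=I$. *)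

theory Defs
  imports
    "HOL-Number_Theory.Residues"
    "Jordan_Normal_Form.Schur_Decomposition"
    "Graph_Theory.Graph_Theory"
begin

text \<open>
  A finite simple graph is a \<open>pair_graph\<close>: a finite, loop-free, symmetric set \<open>parcs G\<close>
  of ordered pairs over \<open>pverts G\<close>. So \<open>parcs G\<close> is exactly the arc set $\mathcal{A}(G)$,
  with $o = $ \<open>fst\<close>, $t = $ \<open>snd\<close> and arc inversion \<open>prod.swap\<close>.
\<close>

definition simple_connected_graph :: "'a pair_pre_digraph \<Rightarrow> bool" where
  "simple_connected_graph G \<longleftrightarrow> pair_graph G \<and> Digraph_Component.connected (with_proj G)"

text \<open>
  Matrices indexed by finite sets are turned into matrices with numerical indices along an
  arbitrary enumeration of each index set. The same enumeration of a set is used throughout,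
  so products are the intended ones; another choice conjugates every square matrix
  by a permutation matrix, which affects neither its eigenvalues nor whether a power is the
  identity.
\<close>

definition set_enum :: "'a set \<Rightarrow> 'a list" where
  "set_enum A = (SOME xs. set xs = A \<and> distinct xs)"

definition set_mat :: "'a set \<Rightarrow> 'b set \<Rightarrow> ('a \<Rightarrow> 'b \<Rightarrow> complex) \<Rightarrow> complex mat" where
  "set_mat A B f = mat (length (set_enum A)) (length (set_enum B))
     (\<lambda>(i, j). f (set_enum A ! i) (set_enum B ! j))"

definition adjacency_matrix :: "'a pair_pre_digraph \<Rightarrow> complex mat" where
  "adjacency_matrix G = set_mat (pverts G) (pverts G) (\<lambda>u v. of_bool ((u, v) \<in> parcs G))"

definition integral_graph :: "'a pair_pre_digraph \<Rightarrow> bool" where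
  "integral_graph G \<longleftrightarrow> (\<forall>k. eigenvalue (adjacency_matrix G) k \<longrightarrow> k \<in> \<int>)"

definition boundary_matrix :: "'a pair_pre_digraph \<Rightarrow> complex mat" where
  "boundary_matrix G = set_mat (pverts G) (parcs G)
     (\<lambda>x a. complex_of_real (1 / sqrt (real (in_degree (with_proj G) x))) * of_bool (x = snd a))"

definition coin_matrix :: "'a pair_pre_digraph \<Rightarrow> complex mat" where
  "coin_matrix G =
     2 \<cdot>\<^sub>m (mat_adjoint (boundary_matrix G) * boundary_matrix G) - 1\<^sub>m (card (parcs G))"

definition shift_matrix :: "'a pair_pre_digraph \<Rightarrow> complex mat" where
  "shift_matrix G = set_mat (parcs G) (parcs G) (\<lambda>a b. of_bool (a = prod.swap b))"

definition evolution_matrix :: "'a pair_pre_digraph \<Rightarrow> complex mat" where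
  "evolution_matrix G = shift_matrix G * coin_matrix G"

definition periodic_graph :: "'a pair_pre_digraph \<Rightarrow> bool" where
  "periodic_graph G \<longleftrightarrow>
     (\<exists>\<tau>>0. evolution_matrix G ^\<^sub>m \<tau> = 1\<^sub>m (card (parcs G)))"

definition unit_squares :: "nat \<Rightarrow> int set" where
  "unit_squares n =
     {r [^]\<^bsub>residue_ring (int n)\<^esub> (2::nat) | r. r \<in> Units (residue_ring (int n))}"

definition connection_set :: "nat \<Rightarrow> int set" where
  "connection_set n =
     unit_squares n \<union> (\<lambda>q. \<ominus>\<^bsub>residue_ring (int n)\<^esub> q) ` unit_squares n"

definition quadratic_unitary_Cayley_graph :: "nat \<Rightarrow> int pair_pre_digraph" where
  "quadratic_unitary_Cayley_graph n =
     \<lparr> pverts = carrier (residue_ring (int n)),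
       parcs = {(u, v). u \<in> carrier (residue_ring (int n)) \<and> v \<in> carrier (residue_ring (int n))
                  \<and> u \<ominus>\<^bsub>residue_ring (int n)\<^esub> v \<in> connection_set n} \<rparr>"

end

(*
  By Hensel lifting the squares of units are the residues 1 mod 3, respectively 1 mod 8, so that
  both graphs are blow-ups of a cycle C_c (c = 3 or c = 8): every vertex of C_c is replaced by a
  class of m independent vertices. In the walk on such a blow-up the total amplitude on the arcs
  from class i - 1 to class i, and likewise from class i + 1 to class i, merely rotates around the
  cycle. The deviation of the amplitude entering a single vertex from its class average changes
  sign every two steps. Hence over four steps an arc value changes by the change of one rotating
  flow, which telescopes to 0 over 4 c steps: U^(4 c) = I for every c. The case c = 3 has only the
  eigenvalues 0, 2 m and - m, and the case c = 8 has 2 m cos (2 pi / 8) = m sqrt 2.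
*)
theory Submission
  imports Defs "HOL-Computational_Algebra.Nth_Powers"
begin

section \<open>Squares of units\<close>

text \<open>Hensel lifting. If \<open>r\<close> squared is \<open>x + 3 ^ k * t\<close>, then
  \<open>r * (1 + 3 ^ k * t)\<close> has the square
  \<open>x + 3 ^ k * t * (1 + 2 * r\<^sup>2)\<close> up to a multiple of \<open>3 ^ (2 * k)\<close>,
  and 3 divides the bracket because the square of \<open>r\<close> is 1 mod 3.\<close>

lemma square_mod_3_power:
  assumes "[x = 1] (mod 3)"
  shows "\<exists>r :: int. [r\<^sup>2 = x] (mod 3 ^ k)"
proof (induction k)
  case (Suc k)
  then obtain r where r: "[r\<^sup>2 = x] (mod 3 ^ k)" ..
  show ?case
  proof (cases k)
    \<comment> \<open>A root modulo \<open>3 ^ 0\<close> carries no information modulo 3, so the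
      root 1 is supplied directly.\<close>
    case 0
    then show ?thesis
      using assms by (intro exI[of _ 1]) (simp add: cong_sym_eq)
  next
    case k: (Suc j)
    obtain t where t: "r\<^sup>2 = x + 3 ^ k * t"
      using r[THEN cong_sym] unfolding cong_iff_lin by blast
    obtain p where p: "x = 1 + 3 * p"
      using assms[THEN cong_sym] unfolding cong_iff_lin by blast
    have r2: "r\<^sup>2 = 1 + 3 * (p + 3 ^ j * t)"
      using t p k by (simp add: algebra_simps)
    have "(r + 3 ^ k * (r * t))\<^sup>2 = r\<^sup>2 + 3 ^ k * t * (2 * r\<^sup>2) + 3 ^ k * 3 ^ k * (r * t)\<^sup>2"
      by (simp add: power2_eq_square algebra_simps)
    also have "\<dots> = x + 3 ^ k * t * (1 + 2 * r\<^sup>2) + 3 ^ k * 3 ^ k * (r * t)\<^sup>2"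
      using t by (simp add: algebra_simps)
    also have "1 + 2 * r\<^sup>2 = 3 * (1 + 2 * (p + 3 ^ j * t))"
      using r2 by simp
    also have "x + 3 ^ k * t * (3 * (1 + 2 * (p + 3 ^ j * t))) + 3 ^ k * 3 ^ k * (r * t)\<^sup>2
      = x + 3 ^ Suc k * (t * (1 + 2 * (p + 3 ^ j * t)) + 3 ^ j * (r * t)\<^sup>2)"
      by (simp add: k algebra_simps)
    finally have "[x = (r + 3 ^ k * (r * t))\<^sup>2] (mod 3 ^ Suc k)"
      unfolding cong_iff_lin by blast
    then show ?thesis
      using cong_sym by blast
  qed
qed simp

text \<open>The derivative \<open>2 * r\<close> is not a unit, so the correction is half the current
  modulus: adding \<open>2 ^ (j + 2)\<close> to the odd number \<open>r\<close> changes its square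
  by \<open>2 ^ (j + 3) * r\<close> modulo \<open>2 ^ (j + 4)\<close>, which turns an odd error
  coefficient \<open>t\<close> into the even \<open>t + r\<close>.\<close>

lemma square_mod_2_power:
  assumes "[x = 1] (mod 8)"
  shows "\<exists>r :: int. [r\<^sup>2 = x] (mod 2 ^ (j + 3))"
proof (induction j)
  case 0
  show ?case
    using assms by (intro exI[of _ 1]) (simp add: cong_sym_eq)
next
  case (Suc j)
  then obtain r where "[r\<^sup>2 = x] (mod 2 ^ (j + 3))" by blast
  then obtain t where t: "r\<^sup>2 = x + 2 ^ (j + 3) * t"
    using cong_sym cong_iff_lin by metis
  \<comment> \<open>For even \<open>t\<close> the old root already works modulo the doubled
    modulus.\<close>
  have "\<exists>q. q\<^sup>2 = x + 2 ^ (Suc j + 3) * l" if "t = 2 * l" for l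
    using that t by (intro exI[of _ r]) (simp add: power_add)
  moreover have "(r + 2 ^ (j + 2))\<^sup>2 = x + 2 ^ (Suc j + 3) * (l + 2 ^ j)" if "t + r = 2 * l" for l
  proof -
    have "(r + 2 ^ (j + 2))\<^sup>2 = r\<^sup>2 + 8 * 2 ^ j * r + 16 * 2 ^ j * 2 ^ j"
      by (simp add: power2_eq_square algebra_simps)
    also have "\<dots> = x + 8 * 2 ^ j * (t + r) + 16 * 2 ^ j * 2 ^ j"
      using t by (simp add: power_add algebra_simps)
    finally show ?thesis
      unfolding that by (simp add: power_add algebra_simps)
  qed
  moreover have "odd r"
  proof -
    have "odd x"
      using assms by (auto simp: cong_def) presburger
    then have "odd (r\<^sup>2)"
      unfolding t by simp
    then show ?thesis by simp
  qed
  ultimately have "\<exists>q l. q\<^sup>2 = x + 2 ^ (Suc j + 3) * l"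
    by (metis even_add dvdE)
  then show ?case
    using cong_sym cong_iff_lin by metis
qed

section \<open>Adjacency in the Cayley graph as a condition modulo \<open>c\<close>\<close>

text \<open>By \<open>squares\<close> and \<open>roots\<close> the squares of units are exactly the
  residues 1 mod \<open>c\<close>, so the connection set consists of the residues 1 and -1 mod
  \<open>c\<close>. Since \<open>c\<close> divides \<open>n\<close>, reduction modulo
  \<open>n\<close> does not disturb these classes.\<close>

lemma quadratic_unitary_Cayley_graph_eq:
  fixes n :: nat and c :: int
  assumes "n > 1" "c dvd int n"
    and squares: "\<And>r. coprime r (int n) \<Longrightarrow> [r\<^sup>2 = 1] (mod c)"
    and roots: "\<And>x. [x = 1] (mod c) \<Longrightarrow> \<exists>r. coprime r (int n) \<and> [r\<^sup>2 = x] (mod int n)"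
  shows "quadratic_unitary_Cayley_graph n =
    \<lparr>pverts = {0..<int n}, parcs = {(u, v). u \<in> {0..<int n} \<and> v \<in> {0..<int n} \<and>
      ([u = v + 1] (mod c) \<or> [u = v - 1] (mod c))}\<rparr>"
proof -
  interpret residues "int n" "residue_ring (int n)"
    by unfold_locales (use assms in auto)
  let ?R = "residue_ring (int n)"
  have pow: "x [^]\<^bsub>?R\<^esub> (2 :: nat) = x\<^sup>2 mod int n" if "x \<in> Units ?R" for x
    using that pow_cong[of x 2] by (auto simp: res_units_eq)
  have us: "unit_squares n = {x \<in> {0..<int n}. [x = 1] (mod c)}"
  proof (intro equalityI subsetI)
    fix x assume "x \<in> unit_squares n"
    then obtain r where r: "r \<in> Units ?R" "x = r\<^sup>2 mod int n"
      unfolding unit_squares_def using pow by auto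
    then have "[r\<^sup>2 = 1] (mod c)"
      using squares by (simp add: res_units_eq)
    then have "[x = 1] (mod c)"
      using r(2) assms(2) by (simp add: cong_def mod_mod_cancel)
    then show "x \<in> {x \<in> {0..<int n}. [x = 1] (mod c)}"
      using r(2) m_gt_one by simp
  next
    fix x assume x: "x \<in> {x \<in> {0..<int n}. [x = 1] (mod c)}"
    then obtain r where r: "coprime r (int n)" "[r\<^sup>2 = x] (mod int n)"
      using roots by blast
    then have unit: "r mod int n \<in> Units ?R"
      using m_gt_one mod_in_res_units by simp
    have "(r mod int n)\<^sup>2 mod int n = x"
      using r(2) x by (simp add: cong_def power_mod)
    then have "x = (r mod int n) [^]\<^bsub>?R\<^esub> (2 :: nat)"
      using pow[OF unit] by simp
    then show "x \<in> unit_squares n"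
      unfolding unit_squares_def using unit by blast
  qed
  have neg: "\<ominus>\<^bsub>?R\<^esub> x = (- x) mod int n" for x
    by (rule res_neg_eq)
  have cs: "connection_set n = {x \<in> {0..<int n}. [x = 1] (mod c) \<or> [x = - 1] (mod c)}"
  proof (intro equalityI subsetI)
    fix x assume "x \<in> connection_set n"
    then consider "x \<in> unit_squares n" | y where "y \<in> unit_squares n" "x = (- y) mod int n"
      unfolding connection_set_def neg by auto
    then show "x \<in> {x \<in> {0..<int n}. [x = 1] (mod c) \<or> [x = - 1] (mod c)}"
    proof cases
      case 2
      then have "[- y = - 1] (mod c)"
        using us by (simp add: cong_minus_minus_iff)
      then have "[x = - 1] (mod c)"
        using 2(2) assms(2) by (simp add: cong_def mod_mod_cancel)
      then show ?thesis
        using 2(2) m_gt_one by simp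
    qed (simp add: us)
  next
    fix x assume x: "x \<in> {x \<in> {0..<int n}. [x = 1] (mod c) \<or> [x = - 1] (mod c)}"
    show "x \<in> connection_set n"
    proof (cases "[x = 1] (mod c)")
      case True
      then show ?thesis
        using x by (simp add: connection_set_def us)
    next
      case False
      define y where "y = (- x) mod int n"
      have "[- x = 1] (mod c)"
        using x False cong_minus_minus_iff[of x "- 1" c] by simp
      then have "[y = 1] (mod c)"
        using assms(2) by (simp add: y_def cong_def mod_mod_cancel)
      then have "y \<in> unit_squares n"
        using m_gt_one by (simp add: us y_def)
      moreover have "x = (- y) mod int n"
        using x by (simp add: y_def mod_minus_eq)
      ultimately show ?thesis
        by (auto simp: connection_set_def neg)
    qed
  qed
  have diff: "u \<ominus>\<^bsub>?R\<^esub> v \<in> connection_set n \<longleftrightarrow> [u = v + 1] (mod c) \<or> [u = v - 1] (mod c)" for u v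
  proof -
    have "u \<ominus>\<^bsub>?R\<^esub> v = (u - v) mod int n"
      by (simp add: a_minus_def neg res_add_eq mod_simps)
    moreover have "[(u - v) mod int n = a] (mod c) \<longleftrightarrow> [u - v = a] (mod c)" for a
      using assms(2) by (simp add: cong_def mod_mod_cancel)
    moreover have "[u - v = 1] (mod c) \<longleftrightarrow> [u = v + 1] (mod c)" "[u - v = - 1] (mod c) \<longleftrightarrow> [u = v - 1] (mod c)"
      by (simp_all add: cong_iff_dvd_diff algebra_simps)
    ultimately show ?thesis
      using m_gt_one by (simp add: cs)
  qed
  have "carrier ?R = {0..<int n}"
    unfolding res_carrier_eq by auto
  then show ?thesis
    unfolding quadratic_unitary_Cayley_graph_def diff by simp
qed

section \<open>Matrices indexed by finite sets\<close>

lemma set_enum: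
  assumes "finite A"
  shows "set (set_enum A) = A" "distinct (set_enum A)" "length (set_enum A) = card A"
proof -
  have "\<exists>xs. set xs = A \<and> distinct xs"
    using finite_distinct_list[OF assms] by blast
  then have *: "set (set_enum A) = A \<and> distinct (set_enum A)"
    unfolding set_enum_def by (rule someI_ex)
  then show "set (set_enum A) = A" "distinct (set_enum A)" by auto
  then show "length (set_enum A) = card A"
    by (metis distinct_card)
qed

lemma set_enum_nth_mem: "finite A \<Longrightarrow> i < card A \<Longrightarrow> set_enum A ! i \<in> A"
  by (metis nth_mem set_enum(1,3))

lemma set_enum_index:
  assumes "finite A" "a \<in> A"
  obtains i where "i < card A" "set_enum A ! i = a"
  using assms by (metis in_set_conv_nth set_enum(1,3))

lemma sum_set_enum:
  assumes "finite A"
  shows "(\<Sum>i = 0..<card A. f (set_enum A ! i)) = sum f A"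
proof -
  have "bij_betw (\<lambda>i. set_enum A ! i) {0..<card A} A"
    using bij_betw_nth[of "set_enum A" "{0..<card A}" A] set_enum[OF assms]
    by (simp add: atLeast0LessThan)
  then show ?thesis
    by (rule sum.reindex_bij_betw)
qed

lemma set_mat_dim [simp]:
  "finite A \<Longrightarrow> dim_row (set_mat A B f) = card A"
  "finite B \<Longrightarrow> dim_col (set_mat A B f) = card B"
  by (simp_all add: set_mat_def set_enum)

lemma set_mat_index [simp]:
  assumes "finite A" "finite B" "i < card A" "j < card B"
  shows "set_mat A B f $$ (i, j) = f (set_enum A ! i) (set_enum B ! j)"
  using assms by (simp add: set_mat_def set_enum)

lemma set_mat_cong:
  assumes "finite A" "finite B" "\<And>a b. a \<in> A \<Longrightarrow> b \<in> B \<Longrightarrow> f a b = g a b"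
  shows "set_mat A B f = set_mat A B g"
  by (rule eq_matI) (use assms in \<open>auto simp: set_enum_nth_mem\<close>)

lemma set_mat_mult:
  assumes "finite A" "finite B" "finite C"
  shows "set_mat A B f * set_mat B C g = set_mat A C (\<lambda>a c. \<Sum>b\<in>B. f a b * g b c)"
proof (rule eq_matI)
  fix i j assume "i < dim_row (set_mat A C (\<lambda>a c. \<Sum>b\<in>B. f a b * g b c))"
    "j < dim_col (set_mat A C (\<lambda>a c. \<Sum>b\<in>B. f a b * g b c))"
  then show "(set_mat A B f * set_mat B C g) $$ (i, j) = set_mat A C (\<lambda>a c. \<Sum>b\<in>B. f a b * g b c) $$ (i, j)"
    using assms sum_set_enum[OF assms(2), of "\<lambda>b. f (set_enum A ! i) b * g b (set_enum C ! j)"]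
    by (simp add: scalar_prod_def)
qed (use assms in auto)

lemma one_mat_eq_set_mat:
  assumes "finite A"
  shows "1\<^sub>m (card A) = set_mat A A (\<lambda>a b. of_bool (a = b))"
  by (rule eq_matI) (use assms in \<open>auto simp: set_enum nth_eq_iff_index_eq\<close>)

lemma mat_adjoint_set_mat:
  assumes "finite A" "finite B"
  shows "mat_adjoint (set_mat A B f) = set_mat B A (\<lambda>b a. cnj (f a b))"
  by (rule eq_matI) (use assms in \<open>auto simp: mat_adjoint_def mat_of_rows_index\<close>)

lemma set_mat_smult_minus:
  assumes "finite A" "finite B"
  shows "k \<cdot>\<^sub>m set_mat A B f - set_mat A B g = set_mat A B (\<lambda>a b. k * f a b - g a b)"
  by (rule eq_matI) (use assms in auto)

section \<open>The Grover walk as a recurrence for functions on arcs\<close>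

text \<open>In a regular graph the two factors \<open>1 / sqrt d\<close> of the boundary matrix
  combine to \<open>1 / d\<close> on pairs of arcs with a common head. The shift matrix then
  replaces the row index by the reversed arc, which turns the head of \<open>a\<close> into its
  tail.\<close>

lemma evolution_matrix_eq_set_mat:
  assumes "pair_graph G"
    and reg: "\<And>x. x \<in> pverts G \<Longrightarrow> in_degree (with_proj G) x = d"
  shows "evolution_matrix G = set_mat (parcs G) (parcs G)
    (\<lambda>a b. 2 / of_nat d * of_bool (fst a = snd b) - of_bool (prod.swap a = b))"
proof -
  interpret pair_graph G by fact
  let ?V = "pverts G" and ?E = "parcs G"
  note fin = pair_finite_verts pair_finite_arcs
  have swap: "prod.swap a \<in> ?E" if "a \<in> ?E" for a
    using that pair_sym_arcs by (cases a) (auto simp: symmetric_def dest: symD)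
  have NN: "(\<Sum>x\<in>?V. cnj (complex_of_real (1 / sqrt (real (in_degree (with_proj G) x))) * of_bool (x = snd a))
      * (complex_of_real (1 / sqrt (real (in_degree (with_proj G) x))) * of_bool (x = snd b)))
      = 1 / of_nat d * of_bool (snd a = snd b)" (is "?L = ?R") if "a \<in> ?E" "b \<in> ?E" for a b
  proof -
    have "?L = (\<Sum>x\<in>?V. if x = snd a then 1 / of_nat d * of_bool (snd a = snd b) else 0)"
    proof (rule sum.cong[OF refl])
      fix x assume "x \<in> ?V"
      have "complex_of_real (sqrt (real d)) * complex_of_real (sqrt (real d)) = of_nat d"
        by (simp flip: of_real_mult)
      then show "cnj (complex_of_real (1 / sqrt (real (in_degree (with_proj G) x))) * of_bool (x = snd a))
      * (complex_of_real (1 / sqrt (real (in_degree (with_proj G) x))) * of_bool (x = snd b))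
        = (if x = snd a then 1 / of_nat d * of_bool (snd a = snd b) else 0)"
        using reg[OF \<open>x \<in> ?V\<close>] by auto
    qed
    also have "\<dots> = ?R"
      using fin that arc_snd_in_verts by simp
    finally show ?thesis .
  qed
  have coin: "coin_matrix G = set_mat ?E ?E
      (\<lambda>a b. 2 * (1 / of_nat d * of_bool (snd a = snd b)) - of_bool (a = b))"
    unfolding coin_matrix_def boundary_matrix_def mat_adjoint_set_mat[OF fin]
      set_mat_mult[OF fin(2,1,2)] one_mat_eq_set_mat[OF fin(2)] set_mat_smult_minus[OF fin(2,2)]
    by (rule set_mat_cong[OF fin(2,2)]) (simp only: NN)
  show ?thesis
    unfolding evolution_matrix_def coin shift_matrix_def set_mat_mult[OF fin(2,2,2)]
  proof (rule set_mat_cong[OF fin(2,2)])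
    fix a b assume ab: "a \<in> ?E" "b \<in> ?E"
    have "(\<Sum>c\<in>?E. of_bool (a = prod.swap c) *
        (2 * (1 / of_nat d * of_bool (snd c = snd b)) - of_bool (c = b)) :: complex)
      = (\<Sum>c\<in>?E. if c = prod.swap a then 
         2 * (1 / of_nat d * of_bool (snd c = snd b)) - of_bool (c = b) else 0)"
      by (rule sum.cong) auto
    also have "\<dots> = 2 / of_nat d * of_bool (fst a = snd b) - of_bool (prod.swap a = b)"
      using fin swap[OF ab(1)] by simp
    finally show "(\<Sum>c\<in>?E. of_bool (a = prod.swap c) *
        (2 * (1 / of_nat d * of_bool (snd c = snd b)) - of_bool (c = b)) :: complex)
      = 2 / of_nat d * of_bool (fst a = snd b) - of_bool (prod.swap a = b)" .
  qed
qed

text \<open>The recursion for \<open>F\<close> multiplies by \<open>f\<close> on the left, so that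
  each column of the power evolves by one application of the matrix per step.\<close>

lemma set_mat_pow:
  assumes "finite A" and "\<And>a b. a \<in> A \<Longrightarrow> b \<in> A \<Longrightarrow> F 0 a b = of_bool (a = b)"
    and "\<And>k a b. a \<in> A \<Longrightarrow> b \<in> A \<Longrightarrow> F (Suc k) a b = (\<Sum>c\<in>A. f a c * F k c b)"
  shows "set_mat A A f ^\<^sub>m k = set_mat A A (F k)"
proof (induction k)
  case 0
  show ?case
    unfolding pow_mat.simps set_mat_dim(1)[OF assms(1)] one_mat_eq_set_mat[OF assms(1)]
    by (rule set_mat_cong) (simp_all add: assms)
next
  case (Suc k)
  have carrier: "set_mat A A f \<in> carrier_mat (card A) (card A)"
    using assms(1) by auto
  \<comment> \<open>\<open>^\<^sub>m\<close> unfolds with the new factor on the right; associativity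
    moves it to the left.\<close>
  have "set_mat A A f ^\<^sub>m Suc j = set_mat A A f * set_mat A A f ^\<^sub>m j" for j
  proof (induction j)
    case 0
    then show ?case
      using carrier assms(1) by simp
  next
    case (Suc j)
    then show ?case
      using assoc_mult_mat[OF carrier pow_carrier_mat[OF carrier] carrier] by simp
  qed
  then have "set_mat A A f ^\<^sub>m Suc k = set_mat A A (\<lambda>a b. \<Sum>c\<in>A. f a c * F k c b)"
    by (simp only: Suc set_mat_mult[OF assms(1,1,1)])
  also have "\<dots> = set_mat A A (F (Suc k))"
    by (rule set_mat_cong) (simp_all add: assms)
  finally show ?case .
qed

text \<open>Column \<open>b\<close> of the \<open>k\<close>-th power of the evolution matrix is the
  state after \<open>k\<close> steps of the walk started in the unit vector at \<open>b\<close>. If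
  every solution of the recurrence returns after \<open>\<tau>\<close> steps, all columns do, and
  the power is the identity.\<close>

lemma periodic_graphI:
  fixes G :: "'a pair_pre_digraph"
  assumes "pair_graph G" and reg: "\<And>x. x \<in> pverts G \<Longrightarrow> in_degree (with_proj G) x = d"
    and "\<tau> > 0"
    and period: "\<And>f. (\<And>k u v. (u, v) \<in> parcs G \<Longrightarrow>
        f (Suc k) u v = 2 / of_nat d * (\<Sum>w | (w, u) \<in> parcs G. f k w u) - f k v u) \<Longrightarrow>
        \<forall>(u, v) \<in> parcs G. f \<tau> u v = (f 0 u v :: complex)"
  shows "periodic_graph G"
proof -
  interpret pair_graph G by fact
  let ?E = "parcs G"
  note fin = pair_finite_verts pair_finite_arcs
  have swap: "(v, u) \<in> ?E" if "(u, v) \<in> ?E" for u v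
    using that pair_sym_arcs by (auto simp: symmetric_def dest: symD)
  define f :: "'a \<times> 'a \<Rightarrow> 'a \<times> 'a \<Rightarrow> complex"
    where "f = (\<lambda>a b. 2 / of_nat d * of_bool (fst a = snd b) - of_bool (prod.swap a = b))"
  define F where "F = rec_nat (\<lambda>a b. of_bool (a = b)) (\<lambda>_ F a b. \<Sum>c\<in>?E. f a c * F c b)"
  have F: "F 0 = (\<lambda>a b. of_bool (a = b))" "F (Suc k) = (\<lambda>a b. \<Sum>c\<in>?E. f a c * F k c b)" for k
    by (simp_all add: F_def)
  have step: "F (Suc k) (u, v) b = 2 / of_nat d * (\<Sum>w | (w, u) \<in> parcs G. F k (w, u) b) - F k (v, u) b"
    if "(u, v) \<in> ?E" for k u v b
  proof -
    have "F (Suc k) (u, v) b = 2 / of_nat d * (\<Sum>c\<in>?E. if snd c = u then F k c b else 0)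
      - (\<Sum>c\<in>?E. if c = (v, u) then F k c b else 0)"
      unfolding F f_def sum_distrib_left sum_subtractf[symmetric]
      by (rule sum.cong) (auto simp: algebra_simps)
    also have "(\<Sum>c\<in>?E. if snd c = u then F k c b else 0) = (\<Sum>c\<in>{c\<in>?E. snd c = u}. F k c b)"
      using fin by (simp add: sum.inter_filter)
    also have "\<dots> = (\<Sum>w | (w, u) \<in> parcs G. F k (w, u) b)"
      by (rule sum.reindex_bij_witness[of _ "\<lambda>w. (w, u)" fst]) auto
    finally show ?thesis
      using fin swap[OF that] by simp
  qed
  have "evolution_matrix G = set_mat ?E ?E f"
    unfolding f_def by (rule evolution_matrix_eq_set_mat) (use assms in auto)
  then have "evolution_matrix G ^\<^sub>m \<tau> = set_mat ?E ?E (F \<tau>)"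
    using set_mat_pow[of ?E F f \<tau>] fin(2) by (simp add: F)
  also have "\<dots> = set_mat ?E ?E (F 0)"
  proof (rule set_mat_cong[OF fin(2,2)])
    fix a b assume "a \<in> ?E" "b \<in> ?E"
    then show "F \<tau> a b = F 0 a b"
      using period[of "\<lambda>k u v. F k (u, v) b"] step by (cases a) auto
  qed
  finally show ?thesis
    using \<open>\<tau> > 0\<close> fin unfolding periodic_graph_def F
    by (auto simp: one_mat_eq_set_mat)
qed

section \<open>Eigenvectors as functions on the vertices\<close>

lemma eigenvalue_adjacency_matrix_iff:
  assumes "finite (pverts G)"
  shows "eigenvalue (adjacency_matrix G) k \<longleftrightarrow>
    (\<exists>g. (\<exists>v\<in>pverts G. g v \<noteq> 0) \<and>
      (\<forall>u\<in>pverts G. (\<Sum>v | v \<in> pverts G \<and> (u, v) \<in> parcs G. g v) = k * g u))"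
proof -
  let ?V = "pverts G" and ?n = "card (pverts G)"
  have mult: "(adjacency_matrix G *\<^sub>v vec ?n (\<lambda>i. g (set_enum ?V ! i))) $ i
      = (\<Sum>v | v \<in> ?V \<and> (set_enum ?V ! i, v) \<in> parcs G. g v)" if "i < ?n" for g i
  proof -
    have "(adjacency_matrix G *\<^sub>v vec ?n (\<lambda>i. g (set_enum ?V ! i))) $ i
      = (\<Sum>j = 0..<?n. of_bool ((set_enum ?V ! i, set_enum ?V ! j) \<in> parcs G) * g (set_enum ?V ! j))"
      using assms that by (simp add: adjacency_matrix_def scalar_prod_def)
    also have "\<dots> = (\<Sum>v\<in>?V. if (set_enum ?V ! i, v) \<in> parcs G then g v else 0)"
      by (subst sum_set_enum[OF assms, of "\<lambda>v. of_bool ((set_enum ?V ! i, v) \<in> parcs G) * g v"])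
        (rule sum.cong, auto)
    finally show ?thesis
      using assms by (simp add: sum.inter_filter)
  qed
  show ?thesis
  proof
    assume "eigenvalue (adjacency_matrix G) k"
    then obtain w where w: "w \<in> carrier_vec ?n" "w \<noteq> 0\<^sub>v ?n" "adjacency_matrix G *\<^sub>v w = k \<cdot>\<^sub>v w"
      using assms by (auto simp: eigenvalue_def eigenvector_def adjacency_matrix_def)
    \<comment> \<open>The choice inverts the enumeration on the vertices; elsewhere the value of
      \<open>g\<close> is arbitrary.\<close>
    define g where "g v = w $ (SOME i. i < ?n \<and> set_enum ?V ! i = v)" for v
    have g: "g (set_enum ?V ! i) = w $ i" if "i < ?n" for i
    proof -
      have "(SOME j. j < ?n \<and> set_enum ?V ! j = set_enum ?V ! i) = i"
        using that set_enum[OF assms] by (intro some_equality) (auto simp: nth_eq_iff_index_eq)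
      then show ?thesis
        by (simp add: g_def)
    qed
    have wg: "w = vec ?n (\<lambda>i. g (set_enum ?V ! i))"
      using w(1) g by (intro eq_vecI) auto
    obtain i where "i < ?n" "w $ i \<noteq> 0"
      using w(1,2) by (metis carrier_vecD eq_vecI index_zero_vec(1) index_zero_vec(2))
    then have "\<exists>v\<in>?V. g v \<noteq> 0"
      using g set_enum_nth_mem[OF assms] by metis
    moreover have "(\<Sum>v | v \<in> ?V \<and> (u, v) \<in> parcs G. g v) = k * g u" if "u \<in> ?V" for u
    proof -
      obtain i where i: "i < ?n" "set_enum ?V ! i = u"
        using set_enum_index[OF assms \<open>u \<in> ?V\<close>] .
      then have "(\<Sum>v | v \<in> ?V \<and> (u, v) \<in> parcs G. g v) = (adjacency_matrix G *\<^sub>v w) $ i"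
        using mult[of i g] wg by simp
      then show ?thesis
        using w i g by auto
    qed
    ultimately show "\<exists>g. (\<exists>v\<in>?V. g v \<noteq> 0) \<and>
      (\<forall>u\<in>?V. (\<Sum>v | v \<in> ?V \<and> (u, v) \<in> parcs G. g v) = k * g u)"
      by blast
  next
    assume "\<exists>g. (\<exists>v\<in>?V. g v \<noteq> 0) \<and>
      (\<forall>u\<in>?V. (\<Sum>v | v \<in> ?V \<and> (u, v) \<in> parcs G. g v) = k * g u)"
    then obtain g v where g: "v \<in> ?V" "g v \<noteq> 0"
      "\<And>u. u \<in> ?V \<Longrightarrow> (\<Sum>v | v \<in> ?V \<and> (u, v) \<in> parcs G. g v) = k * g u"
      by blast
    define w where "w = vec ?n (\<lambda>i. g (set_enum ?V ! i))"
    obtain j where "j < ?n" "set_enum ?V ! j = v"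
      using set_enum_index[OF assms g(1)] .
    then have "w $ j \<noteq> 0" "j < ?n"
      using g(2) by (auto simp: w_def)
    then have "w \<noteq> 0\<^sub>v ?n"
      by auto
    moreover have "adjacency_matrix G *\<^sub>v w = k \<cdot>\<^sub>v w"
    proof (rule eq_vecI)
      fix i assume "i < dim_vec (k \<cdot>\<^sub>v w)"
      then have i: "i < ?n"
        by (simp add: w_def)
      then show "(adjacency_matrix G *\<^sub>v w) $ i = (k \<cdot>\<^sub>v w) $ i"
        using mult[OF i, of g] g(3)[OF set_enum_nth_mem[OF assms i]] by (simp add: w_def)
    qed (use assms in \<open>simp add: w_def adjacency_matrix_def\<close>)
    ultimately show "eigenvalue (adjacency_matrix G) k"
      using assms unfolding eigenvalue_def eigenvector_def
      by (intro exI[of _ w]) (simp add: adjacency_matrix_def w_def)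
  qed
qed

section \<open>Blow-ups of cycles\<close>

text \<open>For \<open>c \<ge> 3\<close> this is the lexicographic product of the cycle of length
  \<open>c\<close> with \<open>m\<close> independent vertices. Using integers as vertices makes the
  Cayley graphs literally equal to blow-ups, so no transfer along isomorphisms arises.\<close>

definition cycle_blowup :: "nat \<Rightarrow> nat \<Rightarrow> int pair_pre_digraph" where
  "cycle_blowup c m =
     \<lparr> pverts = {0..<int (c * m)},
       parcs = {(u, v). u \<in> {0..<int (c * m)} \<and> v \<in> {0..<int (c * m)}
                  \<and> ([u = v + 1] (mod int c) \<or> [u = v - 1] (mod int c))} \<rparr>"

locale blowup_parameters =
  fixes c m :: nat
  assumes c_ge_3: "c \<ge> 3" and m_pos: "m > 0"
begin

abbreviation "V \<equiv> pverts (cycle_blowup c m)"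
abbreviation "E \<equiv> parcs (cycle_blowup c m)"

text \<open>The index ranges over all integers, so steps to \<open>i + 1\<close> and
  \<open>i - 1\<close> around the cycle need no reduction modulo \<open>c\<close>.\<close>

definition cls :: "int \<Rightarrow> int set" where
  "cls i = {v \<in> V. [v = i] (mod int c)}"

lemma finite_V [simp]: "finite V"
  by (simp add: cycle_blowup_def)

lemma finite_cls [simp]: "finite (cls i)"
  by (simp add: cls_def)

lemma cls_cong: "[i = j] (mod int c) \<Longrightarrow> cls i = cls j"
  unfolding cls_def by (metis cong_sym cong_trans)

lemma cls_shift: "v \<in> cls i \<Longrightarrow> cls (v + a) = cls (i + a)"
  unfolding cls_def[of i] by (auto intro!: cls_cong cong_add)

text \<open>Division with remainder by \<open>c\<close>: the quotients of the members of a class are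
  exactly the numbers below \<open>m\<close>.\<close>

lemma card_cls [simp]: "card (cls i) = m"
proof -
  have "bij_betw (\<lambda>k. i mod int c + int c * int k) {..<m} (cls i)"
  proof (rule bij_betwI[where g = "\<lambda>v. nat (v div int c)"])
    show "(\<lambda>k. i mod int c + int c * int k) \<in> {..<m} \<rightarrow> cls i"
    proof
      fix k assume "k \<in> {..<m}"
      then have "int c * int k + int c \<le> int c * int m"
        using mult_left_mono[of "int k + 1" "int m" "int c"] by (simp add: algebra_simps)
      moreover have "0 \<le> i mod int c" "i mod int c < int c"
        using c_ge_3 by simp_all
      ultimately show "i mod int c + int c * int k \<in> cls i"
        by (simp add: cls_def cycle_blowup_def cong_def)
    qed
    show "(\<lambda>v. nat (v div int c)) \<in> cls i \<rightarrow> {..<m}"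
    proof
      fix v assume "v \<in> cls i"
      then have v: "0 \<le> v" "v < int c * int m"
        by (auto simp: cls_def cycle_blowup_def)
      have "int c * (v div int c) \<le> v"
        using c_ge_3 by (simp add: minus_mod_eq_mult_div[symmetric])
      then have "int c * (v div int c) < int c * int m"
        using v(2) by linarith
      then have "v div int c < int m" "0 \<le> v div int c"
        using c_ge_3 v(1) by (simp_all add: pos_imp_zdiv_nonneg_iff)
      then show "nat (v div int c) \<in> {..<m}"
        by auto
    qed
  next
    fix k assume "k \<in> {..<m}"
    then show "nat ((i mod int c + int c * int k) div int c) = k"
      using c_ge_3 by (simp add: div_mult_self2)
  next
    fix v assume v: "v \<in> cls i"
    then have "v mod int c = i mod int c" "0 \<le> v div int c"
      using c_ge_3 by (auto simp: cls_def cycle_blowup_def cong_def pos_imp_zdiv_nonneg_iff)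
    then show "i mod int c + int c * int (nat (v div int c)) = v"
      by (metis int_nat_eq mod_mult_div_eq)
  qed
  then show ?thesis
    using bij_betw_same_card by fastforce
qed

text \<open>A common element would make \<open>c\<close> divide 2. Disjointness yields the degree
  \<open>2 * m\<close> and lets sums over a neighbourhood split.\<close>

lemma cls_disjoint: "cls (i + 1) \<inter> cls (i - 1) = {}"
proof (rule ccontr)
  assume "cls (i + 1) \<inter> cls (i - 1) \<noteq> {}"
  then have "[i + 1 = i - 1] (mod int c)"
    unfolding cls_def by (auto intro: cong_sym cong_trans)
  then have "int c dvd 2"
    by (simp add: cong_iff_dvd_diff)
  then show False
    using c_ge_3 zdvd_imp_le[of "int c" 2] by simp
qed

lemma sum_neighbours:
  "sum g (cls (v + 1) \<union> cls (v - 1)) = sum g (cls (v + 1)) + sum g (cls (v - 1))"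
  using cls_disjoint by (simp add: sum.union_disjoint)

lemma card_neighbours [simp]: "card (cls (v + 1) \<union> cls (v - 1)) = 2 * m"
  using cls_disjoint by (simp add: card_Un_disjoint)

lemma in_neighbours: "v \<in> V \<Longrightarrow> {u. (u, v) \<in> E} = cls (v + 1) \<union> cls (v - 1)"
  by (auto simp: cls_def cycle_blowup_def)

lemma E_sym: "(u, v) \<in> E \<Longrightarrow> (v, u) \<in> E"
  by (auto simp: cycle_blowup_def cong_iff_dvd_diff dvd_diff_commute algebra_simps)

lemma out_neighbours: "v \<in> V \<Longrightarrow> {u. (v, u) \<in> E} = cls (v + 1) \<union> cls (v - 1)"
  using in_neighbours E_sym by blast

lemma E_in_V: "(u, v) \<in> E \<Longrightarrow> u \<in> V" "(u, v) \<in> E \<Longrightarrow> v \<in> V"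
  by (auto simp: cycle_blowup_def)

section \<open>Simplicity, regularity and connectedness\<close>

lemma pair_graph_cycle_blowup: "pair_graph (cycle_blowup c m)"
proof
  show "finite E"
    by (rule finite_subset[of _ "V \<times> V"]) (auto dest: E_in_V)
  show "symmetric (with_proj (cycle_blowup c m))"
    by (auto simp: symmetric_def sym_def E_sym)
  fix e assume e: "e \<in> E"
  show "fst e \<in> V" "snd e \<in> V"
    using e E_in_V by (cases e; simp)+
  show "fst e \<noteq> snd e"
  proof
    assume "fst e = snd e"
    then have "int c dvd 1"
      using e by (cases e) (auto simp: cycle_blowup_def cong_iff_dvd_diff)
    then show False
      using c_ge_3 by simp
  qed
qed simp

lemma in_degree: "v \<in> V \<Longrightarrow> in_degree (with_proj (cycle_blowup c m)) v = 2 * m"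
proof -
  assume v: "v \<in> V"
  have "in_arcs (with_proj (cycle_blowup c m)) v = (\<lambda>u. (u, v)) ` {u. (u, v) \<in> E}"
    by (auto simp: in_arcs_def)
  then show ?thesis
    unfolding in_degree_def by (simp add: card_image inj_on_def in_neighbours[OF v])
qed

text \<open>Consecutive integers are adjacent, so \<open>u\<close>, \<open>u + 1\<close>, ...,
  \<open>v\<close> is a path.\<close>

lemma reachable_cycle_blowup:
  assumes "0 \<le> u" "v < int (c * m)" "u \<le> v"
  shows "u \<rightarrow>\<^sup>*\<^bsub>with_proj (cycle_blowup c m)\<^esub> v"
  using assms(3,2)
proof (induction v rule: int_ge_induct)
  case base
  interpret pair_graph "cycle_blowup c m"
    by (rule pair_graph_cycle_blowup)
  show ?case
    using assms base by (intro reachable_refl) (simp add: cycle_blowup_def)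
next
  case (step v)
  interpret pair_graph "cycle_blowup c m"
    by (rule pair_graph_cycle_blowup)
  have "(v, v + 1) \<in> E"
    using assms(1) step by (simp add: cycle_blowup_def)
  then show ?case
    using step reachable_adj_trans by auto
qed

lemma simple_connected_cycle_blowup: "simple_connected_graph (cycle_blowup c m)"
proof -
  interpret pair_graph "cycle_blowup c m"
    by (rule pair_graph_cycle_blowup)
  let ?G = "with_proj (cycle_blowup c m)"
  have "u \<rightarrow>\<^sup>*\<^bsub>?G\<^esub> v" if "u \<in> V" "v \<in> V" for u v
  proof (cases "u \<le> v")
    case True
    then show ?thesis
      using that by (intro reachable_cycle_blowup) (auto simp: cycle_blowup_def)
  next
    case False
    then have "v \<rightarrow>\<^sup>*\<^bsub>?G\<^esub> u"
      using that by (intro reachable_cycle_blowup) (auto simp: cycle_blowup_def)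
    then show ?thesis
      using symmetric_reachable[OF pair_sym_arcs] by blast
  qed
  moreover have "V \<noteq> {}"
    using c_ge_3 m_pos by (simp add: cycle_blowup_def)
  \<comment> \<open>Connectedness is strong connectedness of the symmetric closure, whose
    reachability agrees with that of a symmetric graph.\<close>
  ultimately have "Digraph_Component.connected ?G"
    unfolding Digraph_Component.connected_def strongly_connected_def
    by (simp add: reachable_mk_symmetric_eq[OF pair_sym_arcs])
  then show ?thesis
    by (simp add: simple_connected_graph_def pair_graph_cycle_blowup)
qed

subsection \<open>Periodicity\<close>

lemma walk_periodic:
  fixes f :: "nat \<Rightarrow> int \<Rightarrow> int \<Rightarrow> complex"
  assumes walk: "\<And>k u v. (u, v) \<in> E \<Longrightarrow>
      f (Suc k) u v = 2 / of_nat (2 * m) * (\<Sum>w | (w, u) \<in> E. f k w u) - f k v u"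
    and uv: "(u, v) \<in> E"
  shows "f (4 * c) u v = f 0 u v"
proof -
  \<comment> \<open>\<open>s\<close> is the inflow at a single vertex; \<open>X\<close> and
    \<open>Y\<close> split the inflow of a whole class by direction of travel around the
    cycle.\<close>
  define s where "s k v = (\<Sum>u\<in>cls (v + 1) \<union> cls (v - 1). f k u v)" for k v
  define X where "X k i = (\<Sum>v\<in>cls i. \<Sum>u\<in>cls (i - 1). f k u v)" for k i
  define Y where "Y k i = (\<Sum>v\<in>cls i. \<Sum>u\<in>cls (i + 1). f k u v)" for k i
  have m0: "of_nat m \<noteq> (0 :: complex)"
    using m_pos by simp
  have step: "f (Suc k) u v = s k u / of_nat m - f k v u" if "(u, v) \<in> E" for k u v
    using walk[OF that, of k] in_neighbours[OF E_in_V(1)[OF that]] by (simp add: s_def)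
  have edge: "(u, v) \<in> E" "(v, u) \<in> E" if "v \<in> cls i" "u \<in> cls (i + 1) \<or> u \<in> cls (i - 1)" for u v i
  proof -
    have "v \<in> V" "u \<in> cls (v + 1) \<union> cls (v - 1)"
      using that cls_shift[OF that(1), of 1] cls_shift[OF that(1), of "- 1"] by (auto simp: cls_def)
    then show "(u, v) \<in> E" "(v, u) \<in> E"
      using in_neighbours E_sym by blast+
  qed
  have s_cls: "(\<Sum>v\<in>cls i. s k v) = X k i + Y k i" for k i
  proof -
    have "s k v = (\<Sum>u\<in>cls (i - 1). f k u v) + (\<Sum>u\<in>cls (i + 1). f k u v)" if "v \<in> cls i" for v
      using cls_shift[OF that, of 1] cls_shift[OF that, of "- 1"] by (simp add: s_def sum_neighbours)
    then show ?thesis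
      by (simp add: X_def Y_def sum.distrib)
  qed
  \<comment> \<open>The arc flows between neighbouring classes rotate around the cycle.\<close>
  have X_Suc: "X (Suc k) i = X k (i - 1)" for k i
  proof -
    have "X (Suc k) i = (\<Sum>v\<in>cls i. \<Sum>u\<in>cls (i - 1). s k u / of_nat m - f k v u)"
      unfolding X_def by (intro sum.cong refl step) (use edge in blast)
    \<comment> \<open>The \<open>m\<close> vertices of class \<open>i\<close> cancel the factor
      \<open>1 / m\<close>. The whole inflow of class \<open>i - 1\<close> remains, minus the part
      that came from class \<open>i\<close>, which is \<open>Y k (i - 1)\<close>.\<close>
    also have "\<dots> = (\<Sum>u\<in>cls (i - 1). s k u) - (\<Sum>v\<in>cls i. \<Sum>u\<in>cls (i - 1). f k v u)"
      using m0 by (simp add: sum_subtractf flip: sum_divide_distrib)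
    also have "(\<Sum>v\<in>cls i. \<Sum>u\<in>cls (i - 1). f k v u) = Y k (i - 1)"
      unfolding Y_def by (subst sum.swap) simp
    finally show ?thesis
      by (simp add: s_cls)
  qed
  have Y_Suc: "Y (Suc k) i = Y k (i + 1)" for k i
  proof -
    have "Y (Suc k) i = (\<Sum>v\<in>cls i. \<Sum>u\<in>cls (i + 1). s k u / of_nat m - f k v u)"
      unfolding Y_def by (intro sum.cong refl step) (use edge in blast)
    also have "\<dots> = (\<Sum>u\<in>cls (i + 1). s k u) - (\<Sum>v\<in>cls i. \<Sum>u\<in>cls (i + 1). f k v u)"
      using m0 by (simp add: sum_subtractf flip: sum_divide_distrib)
    also have "(\<Sum>v\<in>cls i. \<Sum>u\<in>cls (i + 1). f k v u) = X k (i + 1)"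
      unfolding X_def by (subst sum.swap) simp
    finally show ?thesis
      by (simp add: s_cls)
  qed
  have X_shift: "X k i = X 0 (i - int k)" and Y_shift: "Y k i = Y 0 (i + int k)" for k i
    by (induction k arbitrary: i) (simp_all add: X_Suc Y_Suc algebra_simps)
  have "X (k + n) i = X k (i - int n)" "Y (k + n) i = Y k (i + int n)" for k n i
    unfolding X_shift[of "k + n"] X_shift[of k] Y_shift[of "k + n"] Y_shift[of k]
    by (simp_all add: algebra_simps)
  \<comment> \<open>The shift rules are specialised to numerals, and separately to 1, which is not
    of the form \<open>numeral\<close>; unfolding them trades shifts in time for shifts of the
    class.\<close>
  from this[of _ "numeral _"] this[of _ 1]
  have XY_add: "X (k + numeral j) i = X k (i - numeral j)" "X (k + 1) i = X k (i - 1)"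
    "Y (k + numeral j) i = Y k (i + numeral j)" "Y (k + 1) i = Y k (i + 1)" for k j i
    by simp_all
  have XY_cong: "X k i = X k j" "Y k i = Y k j" if "[i = j] (mod int c)" for k i j
    using cls_cong[OF that] cls_cong[OF cong_add[OF that cong_refl], of 1]
      cls_cong[OF cong_diff[OF that cong_refl], of 1] by (simp_all add: X_def Y_def)
  \<comment> \<open>\<open>m * s k v - (X k v + Y k v)\<close>, the deviation of \<open>v\<close> from its class, is negated by two steps.\<close>
  have s_step: "s (k + 2) v + s k v = (X (k + 2) v + Y (k + 2) v + X k v + Y k v) / of_nat m"
    if "v \<in> V" for k v
  proof -
    have v: "v \<in> cls v"
      using that by (simp add: cls_def)
    let ?N = "cls (v + 1) \<union> cls (v - 1)"
    have "s (k + 2) v = (\<Sum>u\<in>?N. s (k + 1) u / of_nat m - f (k + 1) v u)"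
      unfolding s_def[of "k + 2"] using edge[OF v] step[of _ _ "k + 1"] by (intro sum.cong) auto
    also have "\<dots> = (\<Sum>u\<in>?N. s (k + 1) u) / of_nat m - (\<Sum>u\<in>?N. f (k + 1) v u)"
      by (simp add: sum_subtractf sum_divide_distrib)
    also have "(\<Sum>u\<in>?N. f (k + 1) v u) = (\<Sum>u\<in>?N. s k v / of_nat m - f k u v)"
      using edge[OF v] step[of _ _ k] by (intro sum.cong) auto
    \<comment> \<open>The \<open>2 * m\<close> neighbours contribute \<open>2 * s k v\<close>, from
      which the inflow \<open>s k v\<close> is subtracted.\<close>
    also have "\<dots> = s k v"
      using m0 by (simp add: sum_subtractf flip: s_def)
    also have "(\<Sum>u\<in>?N. s (k + 1) u) = X k v + Y k (v + 2) + X k (v - 2) + Y k v"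
      unfolding sum_neighbours s_cls XY_add by (simp add: add_ac)
    finally have "s (k + 2) v + s k v = (X k v + Y k (v + 2) + X k (v - 2) + Y k v) / of_nat m"
      by simp
    then show ?thesis
      unfolding XY_add by (simp add: add_ac)
  qed
  \<comment> \<open>Two steps reverse an arc twice, so \<open>f\<close> returns to the same arc with
    a correction by inflows. Two such corrections pair inflows that lie two time units apart, and
    \<open>s_step\<close> replaces each pair by class flows.\<close>
  have f4: "f (k + 4) u v - f k u v
      = (X (k + 1) u + Y (k + 1) u + X (k + 3) u + Y (k + 3) u
         - (X k v + Y k v + X (k + 2) v + Y (k + 2) v)) / of_nat m ^ 2" for k
  proof -
    have f2: "f (k + 2) u v = f k u v + (s (k + 1) u - s k v) / of_nat m" for k
      using step[OF uv, of "k + 1"] step[OF E_sym[OF uv], of k] by (simp add: diff_divide_distrib)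
    have "f (k + 4) u v - f k u v = ((s (k + 3) u + s (k + 1) u) - (s (k + 2) v + s k v)) / of_nat m"
      using f2[of k] f2[of "k + 2"] by (simp add: add_divide_distrib diff_divide_distrib eval_nat_numeral)
    also have "s (k + 3) u + s (k + 1) u = (X (k + 1) u + Y (k + 1) u + X (k + 3) u + Y (k + 3) u) / of_nat m"
      using s_step[OF E_in_V(1)[OF uv], of "k + 1"] by (simp add: add_ac eval_nat_numeral)
    also have "s (k + 2) v + s k v = (X k v + Y k v + X (k + 2) v + Y (k + 2) v) / of_nat m"
      using s_step[OF E_in_V(2)[OF uv], of k] by (simp add: add_ac)
    finally show ?thesis
      by (simp add: power2_eq_square diff_divide_distrib)
  qed
  \<comment> \<open>The quantity \<open>f k u v - Z k / of_nat m ^ 2\<close> is invariant under four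
    steps, so \<open>f\<close> returns as soon as \<open>Z\<close> does.\<close>
  have telescope: "f (4 * c) u v = f 0 u v"
    if "\<And>k. f (k + 4) u v - f k u v = (Z (k + 4) - Z k) / of_nat m ^ 2" "Z (4 * c) = Z 0" for Z
  proof -
    have eq: "f (k + 4) u v - Z (k + 4) / of_nat m ^ 2 = f k u v - Z k / of_nat m ^ 2" for k
      using that(1)[of k] by (simp add: diff_divide_distrib algebra_simps)
    have "f (4 * j) u v - Z (4 * j) / of_nat m ^ 2 = f 0 u v - Z 0 / of_nat m ^ 2" for j
    proof (induction j)
      case (Suc j)
      have "4 * Suc j = 4 * j + 4"
        by simp
      then show ?case
        by (simp only: eq Suc)
    qed simp
    from this[of c] show ?thesis
      unfolding that(2) by simp
  qed
  have "[u = v + 1] (mod int c) \<or> [u = v - 1] (mod int c)"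
    using uv by (simp add: cycle_blowup_def)
  then show ?thesis
  proof
    assume u: "[u = v + 1] (mod int c)"
    show ?thesis
    \<comment> \<open>With \<open>u\<close> in class \<open>v + 1\<close>,
      \<open>X (k + 1) u\<close> equals \<open>X k v\<close>, \<open>X (k + 3) u\<close> equals
      \<open>X (k + 2) v\<close>, and \<open>Y (k + 1) u\<close> equals \<open>Y (k + 2) v\<close>.
      Only \<open>Y (k + 3) u\<close>, which is \<open>Y (k + 4) v\<close>, and \<open>Y k v\<close>
      survive, so \<open>Z\<close> is \<open>Y\<close> at \<open>v\<close>.\<close>
    proof (rule telescope)
      show "f (k + 4) u v - f k u v = (Y (k + 4) v - Y k v) / of_nat m ^ 2" for k
        unfolding f4 XY_cong[OF u] XY_add by (simp add: add_ac)
      show "Y (4 * c) v = Y 0 v"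
        unfolding Y_shift[of "4 * c"] by (rule XY_cong) (simp add: cong_iff_dvd_diff)
    qed
  next
    assume u: "[u = v - 1] (mod int c)"
    show ?thesis
    \<comment> \<open>The mirror image: now the \<open>Y\<close> terms cancel and \<open>X\<close>
      at \<open>v\<close> plays the part of \<open>Z\<close>.\<close>
    proof (rule telescope)
      show "f (k + 4) u v - f k u v = (X (k + 4) v - X k v) / of_nat m ^ 2" for k
        unfolding f4 XY_cong[OF u] XY_add by (simp add: add_ac)
      show "X (4 * c) v = X 0 v"
        unfolding X_shift[of "4 * c"] by (rule XY_cong) (simp add: cong_iff_dvd_diff)
    qed
  qed
qed

lemma periodic_cycle_blowup: "periodic_graph (cycle_blowup c m)"
proof (rule periodic_graphI[OF pair_graph_cycle_blowup in_degree])
  show "0 < 4 * c"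
    using c_ge_3 by simp
next
  fix f :: "nat \<Rightarrow> int \<Rightarrow> int \<Rightarrow> complex"
  assume "\<And>k u v. (u, v) \<in> E \<Longrightarrow>
    f (Suc k) u v = 2 / of_nat (2 * m) * (\<Sum>w | (w, u) \<in> E. f k w u) - f k v u"
  then show "\<forall>(u, v) \<in> E. f (4 * c) u v = f 0 u v"
    using walk_periodic[of f] by blast
qed

subsection \<open>Eigenvalues\<close>

lemma eigenvalue_cycle_blowup_iff:
  "eigenvalue (adjacency_matrix (cycle_blowup c m)) k \<longleftrightarrow>
    (\<exists>g. (\<exists>v\<in>V. g v \<noteq> 0) \<and>
      (\<forall>u\<in>V. sum g (cls (u + 1)) + sum g (cls (u - 1)) = k * g u))"
proof -
  have "(\<Sum>v | v \<in> V \<and> (u, v) \<in> E. g v) = sum g (cls (u + 1)) + sum g (cls (u - 1))"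
    if "u \<in> V" for u and g :: "int \<Rightarrow> complex"
  proof -
    have "{v. v \<in> V \<and> (u, v) \<in> E} = cls (u + 1) \<union> cls (u - 1)"
      using out_neighbours[OF that] E_in_V by blast
    then show ?thesis
      by (simp add: sum_neighbours)
  qed
  then show ?thesis
    unfolding eigenvalue_adjacency_matrix_iff[OF finite_V] by (simp cong: ball_cong)
qed

text \<open>A cosine wave of one period around the cycle is constant on classes. The addition
  theorem gives the factor \<open>2 * cos (2 * pi / c)\<close>, and the size of a class the factor
  \<open>m\<close>.\<close>

lemma eigenvalue_cos:
  "eigenvalue (adjacency_matrix (cycle_blowup c m)) (complex_of_real (2 * real m * cos (2 * pi / real c)))"
  unfolding eigenvalue_cycle_blowup_iff
proof (intro exI conjI ballI bexI)
  define g where "g v = cos (2 * pi * of_int v / real c)" for v :: int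
  show "complex_of_real (g 0) \<noteq> 0"
    by (simp add: g_def)
  show "0 \<in> V"
    using c_ge_3 m_pos by (simp add: cycle_blowup_def)
  fix u
  have "g v = g i" if "v \<in> cls i" for v i
  proof -
    have "[i = v] (mod int c)"
      using that by (simp add: cls_def cong_sym_eq)
    then obtain l where "v = i + int c * l"
      unfolding cong_iff_lin by blast
    then have "2 * pi * of_int v / real c = 2 * pi * of_int i / real c + 2 * pi * of_int l"
      using c_ge_3 by (simp add: field_simps)
    then show ?thesis
      unfolding g_def by (simp only: cos_add cos_int_2pin sin_int_2pin)
  qed
  then have sum_g: "(\<Sum>v\<in>cls i. complex_of_real (g v)) = of_nat m * g i" for i
    by simp
  have "g (u + 1) + g (u - 1) = 2 * cos (2 * pi / real c) * g u"
    by (simp add: g_def ring_distribs add_divide_distrib diff_divide_distrib cos_add cos_diff)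
  then have "of_nat m * complex_of_real (g (u + 1) + g (u - 1))
      = complex_of_real (2 * real m * cos (2 * pi / real c)) * g u"
    by simp
  then show "(\<Sum>v\<in>cls (u + 1). complex_of_real (g v)) + (\<Sum>v\<in>cls (u - 1). complex_of_real (g v))
      = complex_of_real (2 * real m * cos (2 * pi / real c)) * complex_of_real (g u)"
    unfolding sum_g by (simp only: of_real_add of_real_mult of_real_of_nat_eq ring_distribs)
qed

end

section \<open>The spectra for \<open>c = 3\<close> and \<open>c = 8\<close>\<close>

text \<open>The class sums of an eigenfunction satisfy the eigenvalue equation of a triangle scaled
  by \<open>m\<close>, which leaves \<open>2 * m\<close> and \<open>- m\<close>. If all class sums
  vanish, the adjacency matrix annihilates the eigenfunction and the eigenvalue is 0.\<close>

lemma integral_cycle_blowup_3: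
  assumes "m > 0"
  shows "integral_graph (cycle_blowup 3 m)"
  unfolding integral_graph_def
proof (intro allI impI)
  interpret blowup_parameters 3 m
    using assms by unfold_locales auto
  fix k assume "eigenvalue (adjacency_matrix (cycle_blowup 3 m)) k"
  then obtain g v where v: "v \<in> V" "g v \<noteq> 0"
    and g: "\<And>u. u \<in> V \<Longrightarrow> sum g (cls (u + 1)) + sum g (cls (u - 1)) = k * g u"
    unfolding eigenvalue_cycle_blowup_iff by blast
  define T where "T i = sum g (cls i)" for i
  have kT: "k * T i = of_nat m * (T (i + 1) + T (i - 1))" for i
  proof -
    have "k * T i = (\<Sum>u\<in>cls i. T (i + 1) + T (i - 1))"
      unfolding T_def sum_distrib_left
    proof (rule sum.cong[OF refl])
      fix u assume u: "u \<in> cls i"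
      then show "k * g u = sum g (cls (i + 1)) + sum g (cls (i - 1))"
        using g[of u] cls_shift[OF u, of 1] cls_shift[OF u, of "- 1"] by (simp add: cls_def)
    qed
    then show ?thesis
      by simp
  qed
  have T_mod: "T (i + 2) = T (i - 1)" "T (i - 2) = T (i + 1)" for i
    unfolding T_def by (rule arg_cong[OF cls_cong], simp add: cong_iff_dvd_diff)+
  have "k = 0 \<or> k = 2 * of_nat m \<or> k = - of_nat m"
  proof (rule ccontr)
    assume k: "\<not> ?thesis"
    have "T i = 0" for i
    proof -
      \<comment> \<open>The sum of the three equations: \<open>i\<close>, \<open>i + 1\<close> and
        \<open>i - 1\<close> run through all classes, and each class sum occurs twice on the
        right.\<close>
      have "(k - 2 * of_nat m) * (T i + T (i + 1) + T (i - 1)) = 0"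
        using kT[of i] kT[of "i + 1"] kT[of "i - 1"] T_mod[of i] by (simp add: algebra_simps)
      then have "T i + T (i + 1) + T (i - 1) = 0"
        using k by simp
      then have "T (i + 1) + T (i - 1) = - T i"
        by (simp add: add_eq_0_iff add.assoc)
      then have "(k + of_nat m) * T i = 0"
        using kT[of i] by (simp add: algebra_simps)
      then show ?thesis
        using k by (auto simp: add_eq_0_iff2)
    qed
    then have "k * g v = 0"
      using g[OF v(1)] by (simp add: T_def)
    then show False
      using k v(2) by simp
  qed
  then show "k \<in> \<int>"
    by auto
qed

text \<open>The cosine eigenvalue is \<open>m * sqrt 2\<close>; were it an integer,
  \<open>2 * m\<^sup>2\<close> would be a perfect square.\<close>

lemma not_integral_cycle_blowup_8:
  assumes "m > 0"
  shows "\<not> integral_graph (cycle_blowup 8 m)"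
proof
  interpret blowup_parameters 8 m
    using assms by unfold_locales auto
  assume "integral_graph (cycle_blowup 8 m)"
  then have "complex_of_real (2 * real m * cos (2 * pi / real 8)) \<in> \<int>"
    using eigenvalue_cos unfolding integral_graph_def by blast
  then obtain z where z: "complex_of_real (2 * real m * cos (2 * pi / real 8)) = of_int z"
    by (auto elim: Ints_cases)
  have "2 * pi / real 8 = pi / 4"
    by simp
  then have "real m * sqrt 2 = of_int z"
    using z by (simp only: cos_45) (metis mult.commute mult.left_commute nonzero_mult_div_cancel_left
        of_real_eq_iff of_real_of_int_eq times_divide_eq_right zero_neq_numeral)
  then have "(real m * sqrt 2)\<^sup>2 = (of_int z)\<^sup>2"
    by simp
  then have "real (2 * m\<^sup>2) = real ((nat \<bar>z\<bar>)\<^sup>2)"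
    by (simp add: power_mult_distrib)
  \<comment> \<open>Writing 2 as a prime power makes the criterion applicable that a prime power is
    a square only for an even exponent.\<close>
  then have "2 ^ 1 * m\<^sup>2 = (nat \<bar>z\<bar>)\<^sup>2"
    by (simp only: of_nat_eq_iff power_one_right)
  then have "is_nth_power 2 (2 ^ 1 * m\<^sup>2)"
    by simp
  then have "is_nth_power 2 (2 ^ 1 :: nat)"
    using assms by (subst (asm) is_nth_power_mult_cancel_right) simp_all
  then show False
    by (subst (asm) is_nth_power_prime_power_nat_iff) simp_all
qed

section \<open>The two families\<close>

text \<open>Both residues prime to 3 have square 1 mod 3. Conversely a lifted root of
  \<open>x\<close> has a square that is 1 mod 3 and is therefore a unit.\<close>

lemma quadratic_unitary_Cayley_graph_3_power:
  "quadratic_unitary_Cayley_graph (3 ^ Suc b) = cycle_blowup 3 (3 ^ b)"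
proof -
  have "quadratic_unitary_Cayley_graph (3 ^ Suc b) =
    \<lparr>pverts = {0..<int (3 ^ Suc b)}, parcs = {(u, v). u \<in> {0..<int (3 ^ Suc b)} \<and> v \<in> {0..<int (3 ^ Suc b)} \<and>
      ([u = v + 1] (mod 3) \<or> [u = v - 1] (mod 3))}\<rparr>"
  proof (rule quadratic_unitary_Cayley_graph_eq)
    fix r assume "coprime r (int (3 ^ Suc b))"
    then have "coprime r 3"
      by simp
    then have "\<not> 3 dvd r"
      using coprime_common_divisor[of r 3 3] by auto
    then have "r mod 3 = 1 \<or> r mod 3 = 2"
      by presburger
    then have "(r mod 3)\<^sup>2 mod 3 = 1"
      by auto
    then show "[r\<^sup>2 = 1] (mod 3)"
      by (simp add: cong_def power_mod)
  next
    fix x :: int assume x: "[x = 1] (mod 3)"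
    obtain r where r: "[r\<^sup>2 = x] (mod 3 ^ Suc b)"
      using square_mod_3_power[OF x] by blast
    then have "[r\<^sup>2 = 1] (mod 3)"
      using x cong_trans cong_modulus_mult[of "r\<^sup>2" x 3 "3 ^ b"] by auto
    then have "coprime (r\<^sup>2) 3"
      using cong_imp_coprime[OF cong_sym] by fastforce
    then show "\<exists>r. coprime r (int (3 ^ Suc b)) \<and> [r\<^sup>2 = x] (mod int (3 ^ Suc b))"
      using r by (intro exI[of _ r]) simp
  qed (use one_less_power[of "3::nat" "Suc b"] in simp_all)
  then show ?thesis
    by (simp add: cycle_blowup_def)
qed

text \<open>Every odd number has square 1 mod 8, and the lifted roots are odd. The exponent
  \<open>a + 3\<close> splits off the factor 8.\<close>

lemma quadratic_unitary_Cayley_graph_2_power: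
  "quadratic_unitary_Cayley_graph (2 ^ (a + 3)) = cycle_blowup 8 (2 ^ a)"
proof -
  have "quadratic_unitary_Cayley_graph (2 ^ (a + 3)) =
    \<lparr>pverts = {0..<int (2 ^ (a + 3))}, parcs = {(u, v). u \<in> {0..<int (2 ^ (a + 3))} \<and> v \<in> {0..<int (2 ^ (a + 3))} \<and>
      ([u = v + 1] (mod 8) \<or> [u = v - 1] (mod 8))}\<rparr>"
  proof (rule quadratic_unitary_Cayley_graph_eq)
    fix r assume "coprime r (int (2 ^ (a + 3)))"
    then have "odd r"
      by auto
    then have "r mod 8 = 1 \<or> r mod 8 = 3 \<or> r mod 8 = 5 \<or> r mod 8 = 7"
      by presburger
    then have "(r mod 8)\<^sup>2 mod 8 = 1"
      by auto
    then show "[r\<^sup>2 = 1] (mod 8)"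
      by (simp add: cong_def power_mod)
  next
    fix x :: int assume x: "[x = 1] (mod 8)"
    obtain r where r: "[r\<^sup>2 = x] (mod 2 ^ (a + 3))"
      using square_mod_2_power[OF x] by blast
    then have "[r\<^sup>2 = 1] (mod 8)"
      using x cong_trans cong_modulus_mult[of "r\<^sup>2" x 8 "2 ^ a"] by (auto simp: power_add mult.commute)
    then obtain l where "1 = r\<^sup>2 + 8 * l"
      unfolding cong_iff_lin by blast
    then have "odd (r\<^sup>2 + 8 * l)"
      by simp
    then have "odd r"
      by simp
    then show "\<exists>r. coprime r (int (2 ^ (a + 3))) \<and> [r\<^sup>2 = x] (mod int (2 ^ (a + 3)))"
      using r by (intro exI[of _ r]) simp
  qed (use one_less_power[of "2::nat" "a + 3"] in \<open>simp_all add: power_add\<close>)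
  then show ?thesis
    by (simp add: cycle_blowup_def power_add mult.commute)
qed

section \<open>Infinitely many isomorphism types\<close>

lemma card_verts_cycle_blowup: "card (pverts (cycle_blowup c m)) = c * m"
  by (simp add: cycle_blowup_def del: of_nat_mult)

lemma not_iso_cycle_blowup:
  assumes "c > 0" "m \<noteq> m'"
  shows "\<not> digraph_iso (with_proj (cycle_blowup c m)) (with_proj (cycle_blowup c m'))"
proof
  assume "digraph_iso (with_proj (cycle_blowup c m)) (with_proj (cycle_blowup c m'))"
  then obtain f where f: "pre_digraph.digraph_isomorphism (with_proj (cycle_blowup c m)) f"
    and eq: "with_proj (cycle_blowup c m') = app_iso f (with_proj (cycle_blowup c m))"
    unfolding digraph_iso_def by blast
  have "pverts (cycle_blowup c m') = iso_verts f ` pverts (cycle_blowup c m)"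
    using arg_cong[OF eq, of verts] by simp
  then have "card (pverts (cycle_blowup c m')) = card (pverts (cycle_blowup c m))"
    using f by (simp add: pre_digraph.digraph_isomorphism_def card_image)
  then show False
    using assms by (simp add: card_verts_cycle_blowup)
qed

text \<open>The vertex number \<open>c * h b\<close> separates the members, so the family is
  infinite up to isomorphism and not merely through relabelling. The parameter \<open>P\<close>
  serves both the integral and the nonintegral family.\<close>

lemma infinite_family_cycle_blowup:
  assumes "c > 0" "inj h" "\<And>b :: nat. P (cycle_blowup c (h b))"
  shows "\<exists>\<G> :: int pair_pre_digraph set. infinite \<G> \<and>
    pairwise (\<lambda>G H. \<not> digraph_iso (with_proj G) (with_proj H)) \<G> \<and> (\<forall>G\<in>\<G>. P G)"
proof (intro exI conjI)
  have "inj (\<lambda>b. cycle_blowup c (h b))"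
  proof (rule injI)
    fix b b' assume "cycle_blowup c (h b) = cycle_blowup c (h b')"
    then have "card (pverts (cycle_blowup c (h b))) = card (pverts (cycle_blowup c (h b')))"
      by simp
    then show "b = b'"
      using assms(1) by (simp add: card_verts_cycle_blowup inj_eq[OF assms(2)])
  qed
  then show "infinite (range (\<lambda>b. cycle_blowup c (h b)))"
    using finite_imageD infinite_UNIV_nat by blast
  show "pairwise (\<lambda>G H. \<not> digraph_iso (with_proj G) (with_proj H)) (range (\<lambda>b. cycle_blowup c (h b)))"
  proof (rule pairwiseI)
    fix G H assume GH: "G \<in> range (\<lambda>b. cycle_blowup c (h b))" "H \<in> range (\<lambda>b. cycle_blowup c (h b))" "G \<noteq> H"
    then obtain b b' where b: "G = cycle_blowup c (h b)" "H = cycle_blowup c (h b')"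
      by blast
    with GH(3) have "h b \<noteq> h b'"
      by auto
    then show "\<not> digraph_iso (with_proj G) (with_proj H)"
      unfolding b by (rule not_iso_cycle_blowup[OF assms(1)])
  qed
  show "\<forall>G\<in>range (\<lambda>b. cycle_blowup c (h b)). P G"
    using assms(3) by blast
qed

theorem mainTheorem3:
  shows
    "(\<forall>\<beta>::nat. \<beta> \<ge> 1 \<longrightarrow>
        simple_connected_graph (quadratic_unitary_Cayley_graph (3 ^ \<beta>)) \<and>
        integral_graph (quadratic_unitary_Cayley_graph (3 ^ \<beta>)) \<and>
        periodic_graph (quadratic_unitary_Cayley_graph (3 ^ \<beta>))) \<and>
     (\<forall>\<alpha>::nat. \<alpha> \<ge> 3 \<longrightarrow>
        simple_connected_graph (quadratic_unitary_Cayley_graph (2 ^ \<alpha>)) \<and>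
        \<not> integral_graph (quadratic_unitary_Cayley_graph (2 ^ \<alpha>)) \<and>
        periodic_graph (quadratic_unitary_Cayley_graph (2 ^ \<alpha>))) \<and>
     (\<exists>\<G> :: int pair_pre_digraph set. infinite \<G> \<and>
        pairwise (\<lambda>G H. \<not> digraph_iso (with_proj G) (with_proj H)) \<G> \<and>
        (\<forall>G\<in>\<G>. simple_connected_graph G \<and> integral_graph G \<and> periodic_graph G)) \<and>
     (\<exists>\<G> :: int pair_pre_digraph set. infinite \<G> \<and>
        pairwise (\<lambda>G H. \<not> digraph_iso (with_proj G) (with_proj H)) \<G> \<and>
        (\<forall>G\<in>\<G>. simple_connected_graph G \<and> \<not> integral_graph G \<and> periodic_graph G))"
proof -
  have three: "simple_connected_graph (cycle_blowup 3 (3 ^ b)) \<and> integral_graph (cycle_blowup 3 (3 ^ b)) \<and>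
    periodic_graph (cycle_blowup 3 (3 ^ b))" for b
  proof -
    interpret blowup_parameters 3 "3 ^ b"
      by unfold_locales simp_all
    show ?thesis
      using simple_connected_cycle_blowup integral_cycle_blowup_3 periodic_cycle_blowup m_pos by blast
  qed
  have eight: "simple_connected_graph (cycle_blowup 8 (2 ^ a)) \<and> \<not> integral_graph (cycle_blowup 8 (2 ^ a)) \<and>
    periodic_graph (cycle_blowup 8 (2 ^ a))" for a
  proof -
    interpret blowup_parameters 8 "2 ^ a"
      by unfold_locales simp_all
    show ?thesis
      using simple_connected_cycle_blowup not_integral_cycle_blowup_8 periodic_cycle_blowup m_pos by blast
  qed
  \<comment> \<open>The exponents \<open>\<beta>\<close> and \<open>\<alpha>\<close> correspond to
    the blow-up sizes \<open>3 ^ (\<beta> - 1)\<close> and \<open>2 ^ (\<alpha> - 3)\<close>; the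
    lower bounds make these subtractions exact.\<close>
  have "simple_connected_graph (quadratic_unitary_Cayley_graph (3 ^ \<beta>)) \<and>
        integral_graph (quadratic_unitary_Cayley_graph (3 ^ \<beta>)) \<and>
        periodic_graph (quadratic_unitary_Cayley_graph (3 ^ \<beta>))" if "\<beta> \<ge> 1" for \<beta>
    using three[of "\<beta> - 1"] quadratic_unitary_Cayley_graph_3_power[of "\<beta> - 1"] that by simp
  moreover have "simple_connected_graph (quadratic_unitary_Cayley_graph (2 ^ \<alpha>)) \<and>
        \<not> integral_graph (quadratic_unitary_Cayley_graph (2 ^ \<alpha>)) \<and>
        periodic_graph (quadratic_unitary_Cayley_graph (2 ^ \<alpha>))" if "\<alpha> \<ge> 3" for \<alpha>
    using eight[of "\<alpha> - 3"] quadratic_unitary_Cayley_graph_2_power[of "\<alpha> - 3"] that by simp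
  moreover have "\<exists>\<G> :: int pair_pre_digraph set. infinite \<G> \<and>
        pairwise (\<lambda>G H. \<not> digraph_iso (with_proj G) (with_proj H)) \<G> \<and>
        (\<forall>G\<in>\<G>. simple_connected_graph G \<and> integral_graph G \<and> periodic_graph G)"
    by (rule infinite_family_cycle_blowup[of 3 "\<lambda>b. 3 ^ b"]) (use three in \<open>simp_all add: inj_def\<close>)
  moreover have "\<exists>\<G> :: int pair_pre_digraph set. infinite \<G> \<and>
        pairwise (\<lambda>G H. \<not> digraph_iso (with_proj G) (with_proj H)) \<G> \<and>
        (\<forall>G\<in>\<G>. simple_connected_graph G \<and> \<not> integral_graph G \<and> periodic_graph G)"
    by (rule infinite_family_cycle_blowup[of 8 "\<lambda>a. 2 ^ a"]) (use eight in \<open>simp_all add: inj_def\<close>)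
  ultimately show ?thesis
    by blast
qed

end
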